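(* Let $\mathcal X$ and $\mathcal Y$ be nonzero complex Banach spaces and let $A\in\mathcal B(\mathcal X)$, $B\in\mathcal B(\mathcal Y)$. There exists a polynomial $p$ with complex coefficients such that $p(B)$ is invertible and $$\rho(p(A))\,\rho(p(B)^{-1})<1$$ if and only if $$\widehat{\sigma(A)}\cap\sigma(B)=\emptyset .$$
   Context: $\mathcal B(\mathcal X)$ denotes the bounded linear operators on $\mathcal X$. $\sigma(T)$ is the spectrum of $T$ and $\rho(T)=\sup\{|\lambda|:\lambda\in\sigma(T)\}$ its spectral radius. For compact $K\subset\mathbb C$, $\widehat K$ is the polynomially convex hull $\widehat K=\{z\in\mathbb C: |p(z)|\le\sup_{\zeta\in K}|p(\zeta)|\text{ for all polynomials }p\}$. *)

theory Defs
  imports Complex_Main "HOL-Computational_Algebra.Polynomial"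
begin

text \<open>The real structure of a complex normed space is the restriction of its complex structure;
  \<open>scaleC 1 x = x\<close> and compatibility of the norm with real scalars are then consequences of
  the axioms of the underlying real normed space.\<close>

class complex_normed_vector = real_normed_vector +
  fixes scaleC :: "complex \<Rightarrow> 'a \<Rightarrow> 'a"  (infixr "*\<^sub>C" 75)
  assumes scaleC_add_right: "c *\<^sub>C (x + y) = c *\<^sub>C x + c *\<^sub>C y"
    and scaleC_add_left: "(c + d) *\<^sub>C x = c *\<^sub>C x + d *\<^sub>C x"
    and scaleC_scaleC: "c *\<^sub>C d *\<^sub>C x = (c * d) *\<^sub>C x"
    and scaleR_scaleC: "r *\<^sub>R x = complex_of_real r *\<^sub>C x"
    and norm_scaleC: "norm (c *\<^sub>C x) = cmod c * norm x"

class complex_banach = complex_normed_vector + banach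

instantiation complex :: complex_banach
begin

definition scaleC_complex_def: "c *\<^sub>C (x::complex) = c * x"

instance
  by standard (simp_all add: scaleC_complex_def algebra_simps norm_mult scaleR_conv_of_real)

end

definition bounded_clinear ::
    "('a::complex_normed_vector \<Rightarrow> 'b::complex_normed_vector) \<Rightarrow> bool" where
  "bounded_clinear T \<longleftrightarrow> bounded_linear T \<and> (\<forall>c x. T (c *\<^sub>C x) = c *\<^sub>C T x)"

text \<open>Invertibility in the algebra of bounded operators. The inverse is then \<open>inv T\<close>.\<close>

definition invertible_op :: "('a::complex_normed_vector \<Rightarrow> 'a) \<Rightarrow> bool" where
  "invertible_op T \<longleftrightarrow>
     bounded_clinear T \<and> (\<exists>S. bounded_clinear S \<and> S \<circ> T = id \<and> T \<circ> S = id)"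

definition op_spectrum :: "('a::complex_normed_vector \<Rightarrow> 'a) \<Rightarrow> complex set" where
  "op_spectrum T = {z. \<not> invertible_op (\<lambda>x. z *\<^sub>C x - T x)}"

text \<open>The real-valued supremum is meaningful when the spectrum is nonempty and bounded, as it is
  for a bounded operator on a nonzero complex Banach space.\<close>

definition op_spectral_radius :: "('a::complex_normed_vector \<Rightarrow> 'a) \<Rightarrow> real" where
  "op_spectral_radius T = (SUP z\<in>op_spectrum T. cmod z)"

definition poly_op ::
    "complex poly \<Rightarrow> ('a::complex_normed_vector \<Rightarrow> 'a) \<Rightarrow> ('a \<Rightarrow> 'a)" where
  "poly_op p T = (\<lambda>x. \<Sum>i\<le>degree p. coeff p i *\<^sub>C (T ^^ i) x)"

text \<open>Intended for nonempty compact \<open>K\<close>: the real-valued supremum is unspecified for an empty or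
  unbounded set of values.\<close>

definition polynomial_hull :: "complex set \<Rightarrow> complex set" where
  "polynomial_hull K = {z. \<forall>p. cmod (poly p z) \<le> (SUP w\<in>K. cmod (poly p w))}"

end

theory Submission
  imports Defs "HOL-Analysis.Analysis" "HOL-Computational_Algebra.Fundamental_Theorem_Algebra"
begin

text \<open>By spectral mapping, the left-hand side says that \<open>\<bar>p\<bar>\<close> is smaller on \<open>K = \<sigma>(A)\<close> than its
  minimum on \<open>L = \<sigma>(B)\<close>, so the point is to separate \<open>K\<close> from \<open>L\<close> by one polynomial as soon as the
  hull of \<open>K\<close> misses \<open>L\<close>. Each \<open>z \<in> L\<close> has a polynomial bounded by 1 on \<open>K\<close> and larger than 1 at
  \<open>z\<close>; by compactness there are \<open>\<lambda> > 1\<close> and \<open>E\<close> such that all degrees are at most \<open>E\<close> and all values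
  at \<open>z\<close> at least \<open>\<lambda>\<close>. If \<open>K\<close> is finite, take \<open>q(x) = \<Prod>\<^bsub>a\<in>K\<^esub> (x - a)\<close>. Otherwise,
  for a subset \<open>F\<close> of \<open>K\<close> with \<open>kE + 1\<close> points whose Vandermonde product is
  nearly maximal, let \<open>q(x) = \<Prod>\<^bsub>a\<in>F\<^esub> (x - a)\<close>. Lagrange interpolation on \<open>F\<close> of the \<open>k\<close>-th power of
  the polynomial of \<open>z\<close> gives \<open>\<lambda>\<^sup>k \<bar>q(u)\<bar> \<le> C (kE + 1) \<bar>q(z)\<bar>\<close> for all \<open>u \<in> K\<close>, with \<open>C\<close> depending
  only on the diameter of \<open>K\<close> and its distance from \<open>L\<close>. A large \<open>k\<close> makes \<open>q\<close> separate.

  That the spectrum of an operator \<open>T\<close> is nonempty needs no integration (Rickart). Suppose it is empty and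
  let \<open>\<rho> > 0\<close> be the infimum of the \<open>s\<close> with \<open>\<parallel>T\<^sup>n\<parallel> \<le> s\<^sup>n\<close> for some \<open>n > 0\<close>. The average \<open>f(t)\<close> of
  \<open>z(z - T)\<^sup>-\<^sup>1\<close> over the \<open>n\<close> numbers \<open>z\<close> with \<open>z\<^sup>n = t\<^sup>n\<close> equals \<open>(1 - t\<^sup>-\<^sup>nT\<^sup>n)\<^sup>-\<^sup>1\<close>, and it is Lipschitz
  in \<open>t\<close> with a constant independent of \<open>n\<close>. For \<open>t\<close> slightly above \<open>\<rho>\<close> and suitable \<open>n\<close>, \<open>f(t)\<close> is close to
  the identity, hence so is \<open>f(\<rho>)\<close>, which makes \<open>\<parallel>T\<^sup>n\<parallel>\<close> at most \<open>3/5 \<rho>\<^sup>n\<close>, against the choice of \<open>\<rho>\<close>.\<close>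

section \<open>Separation by a polynomial\<close>

text \<open>Ordered pairs are counted, so this is the squared modulus of the Vandermonde determinant
  of the points of \<open>F\<close>.\<close>

definition vandermonde :: "complex set \<Rightarrow> real" where
  "vandermonde F = (\<Prod>a\<in>F. \<Prod>b\<in>F - {a}. cmod (a - b))"

lemma vandermonde_insert:
  assumes "finite G" "a \<notin> G"
  shows "vandermonde (insert a G) = (\<Prod>b\<in>G. cmod (a - b))\<^sup>2 * vandermonde G"
proof -
  have "(\<Prod>b\<in>insert a G - {c}. cmod (c - b)) = cmod (a - c) * (\<Prod>b\<in>G - {c}. cmod (c - b))"
    if "c \<in> G" for c
  proof -
    have "insert a G - {c} = insert a (G - {c})" using that assms by auto
    then show ?thesis using assms by (simp add: norm_minus_commute)
  qed
  then have "(\<Prod>c\<in>G. \<Prod>b\<in>insert a G - {c}. cmod (c - b)) = (\<Prod>b\<in>G. cmod (a - b)) * vandermonde G"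
    by (simp add: vandermonde_def prod.distrib)
  moreover have "insert a G - {a} = G" using assms by auto
  ultimately show ?thesis
    using assms by (simp add: vandermonde_def power2_eq_square)
qed

lemma vandermonde_pos: "finite F \<Longrightarrow> 0 < vandermonde F"
  by (auto simp: vandermonde_def intro!: prod_pos)

lemma vandermonde_le:
  assumes "finite F" "\<And>a b. a \<in> F \<Longrightarrow> b \<in> F \<Longrightarrow> cmod (a - b) \<le> D"
  shows "vandermonde F \<le> (D ^ (card F - 1)) ^ card F"
proof -
  have "(\<Prod>b\<in>F - {a}. cmod (a - b)) \<le> D ^ (card F - 1)" if "a \<in> F" for a
  proof -
    have "(\<Prod>b\<in>F - {a}. cmod (a - b)) \<le> (\<Prod>b\<in>F - {a}. D)"
      using assms that by (intro prod_mono) auto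
    then show ?thesis using that assms by (simp add: card_Diff_singleton)
  qed
  then have "vandermonde F \<le> (\<Prod>a\<in>F. D ^ (card F - 1))"
    unfolding vandermonde_def by (intro prod_mono) (auto intro!: prod_nonneg)
  then show ?thesis by simp
qed

text \<open>A quarter of the supremum is reached by some set, so no maximiser has to exist.
  Exchanging \<open>a\<close> for \<open>z\<close> multiplies the Vandermonde product by the square
  of the quotient of the two products compared here; that square is at most 4.\<close>

lemma near_fekete_exists:
  assumes "infinite K" and D: "\<And>a b. a \<in> K \<Longrightarrow> b \<in> K \<Longrightarrow> cmod (a - b) \<le> D"
  obtains F where "finite F" "F \<subseteq> K" "card F = n"
    "\<And>a z. a \<in> F \<Longrightarrow> z \<in> K \<Longrightarrow>
       (\<Prod>b\<in>F - {a}. cmod (z - b)) \<le> 2 * (\<Prod>b\<in>F - {a}. cmod (a - b))"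
proof -
  define S where "S = {F. finite F \<and> F \<subseteq> K \<and> card F = n}"
  define M where "M = (SUP F\<in>S. vandermonde F)"
  have "S \<noteq> {}"
    using infinite_arbitrarily_large[OF \<open>infinite K\<close>, of n] by (auto simp: S_def)
  have "vandermonde F \<le> (D ^ (n - 1)) ^ n" if "F \<in> S" for F
    using vandermonde_le[of F D] that D by (auto simp: S_def subset_iff)
  then have bdd: "bdd_above (vandermonde ` S)" by (auto simp: bdd_above_def)
  then have le_M: "vandermonde F \<le> M" if "F \<in> S" for F
    unfolding M_def using that by (intro cSUP_upper)
  have "M > 0"
    using le_M vandermonde_pos \<open>S \<noteq> {}\<close> by (fastforce simp: S_def)
  then have "M / 4 < M" by simp
  then obtain F where F: "F \<in> S" "M / 4 < vandermonde F"
    unfolding M_def using less_cSUP_iff[OF \<open>S \<noteq> {}\<close> bdd] by blast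
  have "(\<Prod>b\<in>F - {a}. cmod (z - b)) \<le> 2 * (\<Prod>b\<in>F - {a}. cmod (a - b))"
    if "a \<in> F" "z \<in> K" for a z
  proof (cases "z \<in> F - {a}")
    \<comment> \<open>The exchange would lose a point here, but the left-hand product has a zero
      factor.\<close>
    case True
    then have "(\<Prod>b\<in>F - {a}. cmod (z - b)) = 0"
      using F by (auto simp: S_def intro!: prod_zero)
    then show ?thesis by (simp add: prod_nonneg)
  next
    case False
    define G where "G = F - {a}"
    have G: "finite G" "a \<notin> G" "z \<notin> G" "insert a G = F"
      using F that False by (auto simp: S_def G_def)
    have "insert z G \<in> S"
      using F G that by (auto simp: S_def)
    then have "vandermonde (insert z G) \<le> 4 * vandermonde (insert a G)"
      using le_M[of "insert z G"] F G by simp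
    then have "(\<Prod>b\<in>G. cmod (z - b))\<^sup>2 * vandermonde G
        \<le> (4 * (\<Prod>b\<in>G. cmod (a - b))\<^sup>2) * vandermonde G"
      unfolding vandermonde_insert[OF G(1,2)] vandermonde_insert[OF G(1,3)] by simp
    then have "(\<Prod>b\<in>G. cmod (z - b))\<^sup>2 \<le> (2 * (\<Prod>b\<in>G. cmod (a - b)))\<^sup>2"
      using vandermonde_pos[OF \<open>finite G\<close>] by (simp add: power_mult_distrib)
    then have "(\<Prod>b\<in>G. cmod (z - b)) \<le> 2 * (\<Prod>b\<in>G. cmod (a - b))"
      by (rule power2_le_imp_le) (simp add: prod_nonneg)
    then show ?thesis by (simp add: G_def)
  qed
  then show ?thesis using that F by (auto simp: S_def)
qed

section \<open>Lagrange interpolation and growth outside \<open>K\<close>\<close>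

text \<open>Both sides are polynomials of degree below \<open>card F\<close> that agree on
  \<open>F\<close>.\<close>

lemma poly_lagrange:
  fixes p :: "'a::field poly"
  assumes "finite F" "degree p < card F"
  shows "poly p z = (\<Sum>a\<in>F. poly p a * (\<Prod>b\<in>F - {a}. (z - b) / (a - b)))"
proof -
  define l where "l a = (\<Prod>b\<in>F - {a}. smult (1 / (a - b)) [:- b, 1:])" for a
  define r where "r = (\<Sum>a\<in>F. smult (poly p a) (l a))"
  have l: "poly (l a) x = (\<Prod>b\<in>F - {a}. (x - b) / (a - b))" for a x
    by (simp add: l_def poly_prod diff_divide_distrib)
  have "degree (l a) < card F" if "a \<in> F" for a
  proof -
    have "degree (l a) \<le> (\<Sum>b\<in>F - {a}. 1)"
      unfolding l_def using assms
      by (intro order.trans[OF degree_prod_sum_le] sum_mono) (auto intro: order.trans[OF degree_smult_le])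
    also have "\<dots> < card F" using that assms by (simp add: card_gt_0_iff card_Diff_singleton)
    finally show ?thesis .
  qed
  then have "degree r < card F"
    unfolding r_def using assms
    by (intro degree_sum_less) (auto intro: le_less_trans[OF degree_smult_le])
  moreover have "poly r x = poly p x" if "x \<in> F" for x
  proof -
    have "poly (l a) x = (if a = x then 1 else 0)" if "a \<in> F" for a
      using \<open>x \<in> F\<close> that assms by (auto simp: l intro!: prod.neutral prod_zero)
    then have "poly r x = (\<Sum>a\<in>F. if a = x then poly p a else 0)"
      unfolding r_def poly_sum by (intro sum.cong) auto
    then show ?thesis using assms that by simp
  qed
  ultimately have "r = p"
    using assms by (intro poly_eqI_degree[of F]) auto
  then have "poly p z = poly r z" by simp
  then show ?thesis by (simp add: r_def poly_sum l)
qed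

text \<open>A Bernstein-Walsh type estimate. In each Lagrange term the basis polynomial at
  \<open>z\<close> has modulus \<open>W / V\<close>; the extremal property gives
  \<open>q u \<le> 2 * D * V\<close>, and \<open>d * W \<le> q z\<close>. So \<open>V\<close>
  cancels, and summing over \<open>F\<close> contributes the factor \<open>card F\<close>.\<close>

lemma near_fekete_growth:
  fixes P :: "complex poly"
  assumes F: "finite F" "F \<subseteq> K" "degree P < card F"
    and fek: "\<And>a z. a \<in> F \<Longrightarrow> z \<in> K \<Longrightarrow>
       (\<Prod>b\<in>F - {a}. cmod (z - b)) \<le> 2 * (\<Prod>b\<in>F - {a}. cmod (a - b))"
    and D: "\<And>a b. a \<in> K \<Longrightarrow> b \<in> K \<Longrightarrow> cmod (a - b) \<le> D"
    and P: "\<And>a. a \<in> K \<Longrightarrow> cmod (poly P a) \<le> 1"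
    and d: "0 < d" "\<And>a. a \<in> K \<Longrightarrow> d \<le> cmod (z - a)"
    and u: "u \<in> K"
  shows "cmod (poly P z) * (\<Prod>b\<in>F. cmod (u - b))
    \<le> real (card F) * (2 * D / d) * (\<Prod>b\<in>F. cmod (z - b))"
proof -
  define q where "q x = (\<Prod>b\<in>F. cmod (x - b))" for x
  have "D \<ge> 0" using D[OF u u] by simp
  have each: "cmod (poly P a * (\<Prod>b\<in>F - {a}. (z - b) / (a - b))) * q u \<le> 2 * D / d * q z"
    if "a \<in> F" for a
  proof -
    define V where "V = (\<Prod>b\<in>F - {a}. cmod (a - b))"
    define W where "W = (\<Prod>b\<in>F - {a}. cmod (z - b))"
    have aK: "a \<in> K" using that F by auto
    have "V > 0" unfolding V_def by (intro prod_pos) auto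
    have "W \<ge> 0" unfolding W_def by (intro prod_nonneg) auto
    have qz: "q z = cmod (z - a) * W"
      unfolding q_def W_def using F that by (simp add: prod.remove[of F a])
    have "q u = cmod (u - a) * (\<Prod>b\<in>F - {a}. cmod (u - b))"
      unfolding q_def using F that by (simp add: prod.remove[of F a])
    also have "\<dots> \<le> D * (2 * V)"
      unfolding V_def using D[OF u aK] fek[OF that u] \<open>D \<ge> 0\<close> by (intro mult_mono prod_nonneg) auto
    finally have qu: "q u \<le> 2 * D * V" by simp
    have "cmod (poly P a * (\<Prod>b\<in>F - {a}. (z - b) / (a - b))) = cmod (poly P a) * (W / V)"
      by (simp add: norm_mult prod_norm[symmetric] norm_divide V_def W_def prod_dividef)
    also have "\<dots> \<le> W / V"
      using P[OF aK] \<open>V > 0\<close> \<open>W \<ge> 0\<close> by (intro mult_left_le_one_le) auto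
    finally have "cmod (poly P a * (\<Prod>b\<in>F - {a}. (z - b) / (a - b))) * q u \<le> W / V * (2 * D * V)"
      using qu \<open>V > 0\<close> \<open>W \<ge> 0\<close> by (intro mult_mono) (auto simp: q_def intro!: prod_nonneg)
    also have "\<dots> = 2 * D / d * (d * W)"
      using \<open>V > 0\<close> \<open>d > 0\<close> by simp
    also have "\<dots> \<le> 2 * D / d * q z"
      unfolding qz using \<open>D \<ge> 0\<close> \<open>d > 0\<close> \<open>W \<ge> 0\<close> d(2)[OF aK] by (intro mult_left_mono mult_right_mono) auto
    finally show ?thesis .
  qed
  have "cmod (poly P z) * q u
      \<le> (\<Sum>a\<in>F. cmod (poly P a * (\<Prod>b\<in>F - {a}. (z - b) / (a - b)))) * q u"
    by (subst poly_lagrange[OF F(1,3), of z], intro mult_right_mono norm_sum)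
      (simp add: q_def prod_nonneg)
  also have "\<dots> \<le> (\<Sum>a\<in>F. 2 * D / d * q z)"
    unfolding sum_distrib_right by (intro sum_mono each)
  finally show ?thesis by (simp add: q_def)
qed

section \<open>From a separating polynomial for each point to a single one\<close>

text \<open>Akin to Hilbert's lemniscate theorem. The hull condition supplies a polynomial that
  depends on \<open>z\<close>; the gain is a single \<open>q\<close> for all of \<open>L\<close>,
  with a strict gap.\<close>

lemma polynomial_separation:
  fixes K L :: "complex set"
  assumes K: "compact K" "K \<noteq> {}" and L: "compact L"
    and disj: "polynomial_hull K \<inter> L = {}"
  obtains q s m where "0 \<le> s" "s < m"
    "\<And>w. w \<in> K \<Longrightarrow> cmod (poly q w) \<le> s" "\<And>z. z \<in> L \<Longrightarrow> m \<le> cmod (poly q z)"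
proof (cases "L = {}")
  case True
  then show ?thesis using that[of 0 1 0] by simp
next
  case Lne: False
  note sep = that
  have bddK: "bdd_above ((\<lambda>w. cmod (poly p w)) ` K)" for p
    using K by (intro bounded_imp_bdd_above compact_imp_bounded compact_continuous_image
        continuous_intros) auto
  have "K \<subseteq> polynomial_hull K"
    unfolding polynomial_hull_def using bddK by (auto intro!: cSUP_upper)
  then have KL: "K \<inter> L = {}" using disj by auto
  \<comment> \<open>A factor 2 between the two sets is enough: \<open>m\<close> is the minimum of
    the modulus on \<open>L\<close>, \<open>s\<close> is half of it, and nonvanishing on
    \<open>L\<close> makes the gap strict.\<close>
  have *: thesis if q: "\<And>u z. u \<in> K \<Longrightarrow> z \<in> L \<Longrightarrow> 2 * cmod (poly q u) \<le> cmod (poly q z)"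
    "\<And>z. z \<in> L \<Longrightarrow> poly q z \<noteq> 0" for q
  proof -
    have "continuous_on L (\<lambda>z. cmod (poly q z))" by (intro continuous_intros)
    then obtain z0 where z0: "z0 \<in> L" "\<And>z. z \<in> L \<Longrightarrow> cmod (poly q z0) \<le> cmod (poly q z)"
      using continuous_attains_inf[OF L Lne] by blast
    show thesis
      using q(1)[OF _ z0(1)] q(2)[OF z0(1)] z0(2)
      by (intro sep[of "cmod (poly q z0) / 2" "cmod (poly q z0)" q]) (auto simp: mult.commute)
  qed
  show thesis
  proof (cases "finite K")
    case True
    define q where "q = (\<Prod>w\<in>K. [:- w, 1:])"
    have "u \<in> K \<Longrightarrow> poly q u = 0" "u \<notin> K \<Longrightarrow> poly q u \<noteq> 0" for u
      using True by (auto simp: q_def poly_prod)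
    then show ?thesis
      by (intro *[of q]) (use KL in auto)
  next
    case Kinf: False
    define Q where "Q = {p :: complex poly. \<forall>w\<in>K. cmod (poly p w) \<le> 1}"
    \<comment> \<open>The natural number in the index records by how much the value exceeds 1, so
      that a finite subcover bounds degrees and margins at once.\<close>
    define U where "U x = {z. 1 + inverse (real (Suc (snd x))) < cmod (poly (fst x) z)}"
      for x :: "complex poly \<times> nat"
    have "\<exists>x\<in>Q \<times> UNIV. z \<in> U x" if "z \<in> L" for z
    proof -
      have "z \<notin> polynomial_hull K" using disj that by blast
      then obtain p where "(SUP w\<in>K. cmod (poly p w)) < cmod (poly p z)"
        unfolding polynomial_hull_def mem_Collect_eq not_all not_le by blast
      \<comment> \<open>The supremum may be 0, whereas a level \<open>t\<close> strictly above it is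
        positive and can be divided out.\<close>
      then obtain t where t: "(SUP w\<in>K. cmod (poly p w)) < t" "t < cmod (poly p z)"
        using dense by blast
      have "cmod (poly p w) < t" if "w \<in> K" for w
        using t(1) cSUP_upper[OF that bddK, of p] by linarith
      moreover from this have "t > 0" using K(2) norm_ge_zero le_less_trans by blast
      moreover define p' where "p' = smult (of_real (1 / t)) p"
      ultimately have "p' \<in> Q" "1 < cmod (poly p' z)"
        using t by (auto simp: Q_def p'_def norm_mult norm_divide less_imp_le)
      moreover obtain n where "inverse (real (Suc n)) < cmod (poly p' z) - 1"
        using reals_Archimedean[of "cmod (poly p' z) - 1"] calculation by auto
      ultimately show ?thesis by (intro bexI[of _ "(p', n)"]) (auto simp: U_def)
    qed
    then have cover: "L \<subseteq> (\<Union>x\<in>Q \<times> UNIV. U x)" by blast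
    have "open (U x)" for x
      unfolding U_def by (intro open_Collect_less continuous_intros)
    then obtain C where C: "C \<subseteq> Q \<times> UNIV" "finite C" "L \<subseteq> (\<Union>x\<in>C. U x)"
      using compactE_image[OF L, of "Q \<times> UNIV" U] cover by metis
    obtain N where N: "\<And>x. x \<in> C \<Longrightarrow> snd x \<le> N"
      using C(2) by (meson finite_imageI finite_nat_set_iff_bounded_le image_eqI)
    obtain E where E: "\<And>x. x \<in> C \<Longrightarrow> degree (fst x) \<le> E"
      using finite_nat_set_iff_bounded_le[of "(\<lambda>x. degree (fst x)) ` C"] C(2) by auto
    define l where "l = 1 + inverse (real (Suc N))"
    have "l > 1" by (simp add: l_def)
    have big: "\<exists>p\<in>Q. degree p \<le> E \<and> l \<le> cmod (poly p z)" if "z \<in> L" for z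
    proof -
      obtain x where x: "x \<in> C" "z \<in> U x" using C(3) \<open>z \<in> L\<close> by blast
      have "inverse (real (Suc N)) \<le> inverse (real (Suc (snd x)))"
        using N[OF x(1)] by (intro le_imp_inverse_le) auto
      moreover have "1 + inverse (real (Suc (snd x))) < cmod (poly (fst x) z)"
        using x(2) by (simp only: U_def mem_Collect_eq)
      ultimately have "l \<le> cmod (poly (fst x) z)" unfolding l_def by linarith
      then show ?thesis using x(1) C(1) E by (intro bexI[of _ "fst x"]) auto
    qed
    obtain d where d: "0 < d" "\<And>a z. a \<in> K \<Longrightarrow> z \<in> L \<Longrightarrow> d \<le> cmod (z - a)"
      using separate_compact_closed[of L K] K L KL compact_imp_closed
      by (metis dist_norm inf_commute)
    obtain D where D: "\<And>a b. a \<in> K \<Longrightarrow> b \<in> K \<Longrightarrow> cmod (a - b) \<le> D"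
      using compact_imp_bounded[OF K(1)] by (metis bounded_two_points dist_norm)
    \<comment> \<open>The number of nodes grows linearly in \<open>k\<close>, the gain
      \<open>l ^ k\<close> exponentially. The extra factor 2 is the one required by
      \<open>*\<close>.\<close>
    have "(\<lambda>k. real (k * E + 1) * (2 * D / d) * 2 / l ^ k) \<longlonglongrightarrow> 0"
    proof -
      have "(\<lambda>k. real k / l ^ k) \<longlonglongrightarrow> 0" "(\<lambda>k. inverse (l ^ k)) \<longlonglongrightarrow> 0"
        using lim_n_over_pown[of l] LIMSEQ_inverse_realpow_zero[OF \<open>l > 1\<close>] \<open>l > 1\<close> by auto
      then have "(\<lambda>k. real k / l ^ k * (real E * (2 * D / d) * 2) + inverse (l ^ k) * ((2 * D / d) * 2))
          \<longlonglongrightarrow> 0 * (real E * (2 * D / d) * 2) + 0 * ((2 * D / d) * 2)"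
        by (intro tendsto_intros)
      then show ?thesis by (simp add: divide_inverse algebra_simps)
    qed
    then have "\<forall>\<^sub>F k in sequentially. real (k * E + 1) * (2 * D / d) * 2 / l ^ k < 1"
      by (rule order_tendstoD) simp
    then obtain k where k: "real (k * E + 1) * (2 * D / d) * 2 / l ^ k < 1"
      by (meson eventually_sequentially order_refl)
    \<comment> \<open>Powers \<open>p ^ k\<close> with \<open>degree p \<le> E\<close> have degree
      at most \<open>k * E\<close>, one less than the number of nodes.\<close>
    obtain F where F: "finite F" "F \<subseteq> K" "card F = k * E + 1"
      "\<And>a z. a \<in> F \<Longrightarrow> z \<in> K \<Longrightarrow>
       (\<Prod>b\<in>F - {a}. cmod (z - b)) \<le> 2 * (\<Prod>b\<in>F - {a}. cmod (a - b))"
      using near_fekete_exists[OF Kinf D, of "k * E + 1"] by metis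
    define q where "q = (\<Prod>w\<in>F. [:- w, 1:])"
    have q: "cmod (poly q x) = (\<Prod>w\<in>F. cmod (x - w))" for x
      by (simp add: q_def poly_prod prod_norm)
    show ?thesis
    proof (rule *[of q])
      fix z assume "z \<in> L"
      then show "poly q z \<noteq> 0" using F KL by (auto simp: q_def poly_prod)
      fix u assume "u \<in> K"
      \<comment> \<open>Only \<open>p\<close> depends on \<open>z\<close>; \<open>k\<close>,
        \<open>F\<close> and \<open>q\<close> are already fixed, so the same \<open>q\<close> serves
        every point of \<open>L\<close>.\<close>
      obtain p where p: "p \<in> Q" "degree p \<le> E" "l \<le> cmod (poly p z)"
        using big[OF \<open>z \<in> L\<close>] by blast
      have deg: "degree (p ^ k) < card F"
        using degree_power_le[of p k] p(2) F(3)
        by (metis add.commute le_imp_less_Suc mult.commute mult_le_mono2 order_trans plus_1_eq_Suc)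
      have "l ^ k * cmod (poly q u) \<le> cmod (poly (p ^ k) z) * cmod (poly q u)"
        using p \<open>l > 1\<close> by (intro mult_right_mono) (auto simp: norm_power intro!: power_mono)
      also have "\<dots> \<le> real (card F) * (2 * D / d) * cmod (poly q z)"
        unfolding q
        by (rule near_fekete_growth[OF F(1,2) deg F(4) D _ d(1) d(2)[OF _ \<open>z \<in> L\<close>] \<open>u \<in> K\<close>])
          (use p in \<open>auto simp: Q_def norm_power power_le_one\<close>)
      finally have "2 * (l ^ k * cmod (poly q u)) \<le> real (k * E + 1) * (2 * D / d) * 2 * cmod (poly q z)"
        by (simp add: F(3))
      also have "\<dots> \<le> l ^ k * cmod (poly q z)"
      proof (intro mult_right_mono)
        have "0 < l ^ k" using \<open>l > 1\<close> by simp
        with k show "real (k * E + 1) * (2 * D / d) * 2 \<le> l ^ k"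
          by (simp only: divide_less_eq_1_pos less_imp_le)
      qed simp
      finally show "2 * cmod (poly q u) \<le> cmod (poly q z)"
        using \<open>l > 1\<close> by simp
    qed
  qed
qed

section \<open>The spectrum of a bounded operator\<close>

lemma scaleC_one [simp]: "1 *\<^sub>C x = (x :: 'a::complex_normed_vector)"
  using scaleR_scaleC[of 1 x] by simp

global_interpretation complex_vector:
  vector_space "scaleC :: complex \<Rightarrow> 'a \<Rightarrow> 'a::complex_normed_vector"
  by standard (simp_all add: scaleC_add_right scaleC_add_left scaleC_scaleC)

lemma bounded_clinearI:
  assumes "\<And>x y. T (x + y) = T x + T y" "\<And>c x. T (c *\<^sub>C x) = c *\<^sub>C T x"
    "\<And>x. norm (T x) \<le> K * norm x"
  shows "bounded_clinear T"
  unfolding bounded_clinear_def using assms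
  by (auto intro!: bounded_linear_intro[of _ K] simp: scaleR_scaleC mult.commute)

context
  fixes T :: "'a::complex_normed_vector \<Rightarrow> 'b::complex_normed_vector"
  assumes T: "bounded_clinear T"
begin

lemma bounded_clinear_bounded_linear: "bounded_linear T"
  using T by (simp add: bounded_clinear_def)

lemma bounded_clinear_add: "T (x + y) = T x + T y"
  by (rule linear_add[OF bounded_linear.linear[OF bounded_clinear_bounded_linear]])

lemma bounded_clinear_diff: "T (x - y) = T x - T y"
  by (rule linear_diff[OF bounded_linear.linear[OF bounded_clinear_bounded_linear]])

lemma bounded_clinear_sum: "T (sum f S) = (\<Sum>i\<in>S. T (f i))"
  by (rule linear_sum[OF bounded_linear.linear[OF bounded_clinear_bounded_linear]])

lemma bounded_clinear_scaleC: "T (c *\<^sub>C x) = c *\<^sub>C T x"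
  using T by (simp add: bounded_clinear_def)

lemma bounded_clinear_0: "T 0 = 0"
  by (rule linear_0[OF bounded_linear.linear[OF bounded_clinear_bounded_linear]])

lemma bounded_clinear_boundE:
  obtains K where "0 < K" "\<And>x. norm (T x) \<le> K * norm x"
  using bounded_linear.pos_bounded[OF bounded_clinear_bounded_linear] by (metis mult.commute)

end

lemma bounded_clinear_ident: "bounded_clinear (\<lambda>x. x)"
  by (simp add: bounded_clinear_def bounded_linear_ident)

lemma bounded_clinear_zero: "bounded_clinear (\<lambda>x. 0)"
  by (simp add: bounded_clinear_def bounded_linear_zero)

lemma bounded_clinear_scaleC_right:
  assumes "bounded_clinear T"
  shows "bounded_clinear (\<lambda>x. c *\<^sub>C T x)"
proof -
  obtain K where K: "0 < K" "\<And>x. norm (T x) \<le> K * norm x"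
    using bounded_clinear_boundE[OF assms] by blast
  show ?thesis
  proof (rule bounded_clinearI)
    show "norm (c *\<^sub>C T x) \<le> (cmod c * K) * norm x" for x
      using mult_left_mono[OF K(2)[of x], of "cmod c"] by (simp add: norm_scaleC mult_ac)
  qed (simp_all add: bounded_clinear_add[OF assms] bounded_clinear_scaleC[OF assms]
      scaleC_add_right scaleC_scaleC mult.commute)
qed

lemma bounded_clinear_plus:
  "bounded_clinear S \<Longrightarrow> bounded_clinear T \<Longrightarrow> bounded_clinear (\<lambda>x. S x + T x)"
  by (auto simp: bounded_clinear_def scaleC_add_right intro: bounded_linear_add)

lemma bounded_clinear_minus:
  "bounded_clinear S \<Longrightarrow> bounded_clinear T \<Longrightarrow> bounded_clinear (\<lambda>x. S x - T x)"
  by (auto simp: bounded_clinear_def complex_vector.scale_right_diff_distrib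
      intro: bounded_linear_sub)

lemma bounded_clinear_compose:
  "bounded_clinear S \<Longrightarrow> bounded_clinear T \<Longrightarrow> bounded_clinear (\<lambda>x. S (T x))"
  by (auto simp: bounded_clinear_def intro: bounded_linear_compose)

lemma bounded_clinear_sum':
  "(\<And>i. i \<in> I \<Longrightarrow> bounded_clinear (f i)) \<Longrightarrow> bounded_clinear (\<lambda>x. \<Sum>i\<in>I. f i x)"
  by (induction I rule: infinite_finite_induct) (auto intro: bounded_clinear_zero bounded_clinear_plus)

lemma bounded_clinear_funpow:
  fixes T :: "'a::complex_normed_vector \<Rightarrow> 'a"
  shows "bounded_clinear T \<Longrightarrow> bounded_clinear (T ^^ n)"
proof (induction n)
  case 0
  have "T ^^ 0 = (\<lambda>x. x)" by (rule ext) simp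
  then show ?case by (simp only: bounded_clinear_ident)
next
  case (Suc n)
  have "T ^^ Suc n = (\<lambda>x. T ((T ^^ n) x))" by (rule ext) simp
  then show ?case using Suc by (simp only: bounded_clinear_compose)
qed

lemmas bounded_clinear_intros =
  bounded_clinear_ident bounded_clinear_zero bounded_clinear_scaleC_right bounded_clinear_plus
  bounded_clinear_minus bounded_clinear_sum' bounded_clinear_funpow

section \<open>Invertibility\<close>

text \<open>The lower bound gives injectivity and, read at \<open>inv T x\<close>, the norm bound of
  the inverse. In this form invertibility can be checked by estimates.\<close>

lemma invertible_op_iff:
  "invertible_op T \<longleftrightarrow>
     bounded_clinear T \<and> surj T \<and> (\<exists>c. \<forall>x. norm x \<le> c * norm (T x))"
proof (intro iffI conjI)
  assume "invertible_op T"
  then obtain S where T: "bounded_clinear T" and S: "bounded_clinear S" "S \<circ> T = id" "T \<circ> S = id"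
    by (auto simp: invertible_op_def)
  show "bounded_clinear T" by fact
  show "surj T" using S(3) by (metis comp_apply id_apply surjI)
  from S(1) obtain K where K: "\<And>x. norm (S x) \<le> K * norm x" using bounded_clinear_boundE by blast
  have "norm x \<le> K * norm (T x)" for x using K[of "T x"] S(2) by (simp add: fun_eq_iff)
  then show "\<exists>c. \<forall>x. norm x \<le> c * norm (T x)" by blast
next
  assume *: "bounded_clinear T \<and> surj T \<and> (\<exists>c. \<forall>x. norm x \<le> c * norm (T x))"
  then obtain c where c: "\<And>x. norm x \<le> c * norm (T x)" by blast
  have T: "bounded_clinear T" "surj T" using * by auto
  have "inj T"
  proof
    fix x y assume "T x = T y"
    then show "x = y" using c[of "x - y"] T by (simp add: bounded_clinear_diff)
  qed
  have TS: "T (inv T y) = y" for y using T(2) by (rule surj_f_inv_f)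
  have ST: "inv T (T x) = x" for x using \<open>inj T\<close> by simp
  have "bounded_clinear (inv T)"
  proof (rule bounded_clinearI)
    show "inv T (x + y) = inv T x + inv T y" for x y
      by (metis ST TS bounded_clinear_add[OF T(1)])
    show "inv T (a *\<^sub>C x) = a *\<^sub>C inv T x" for a x
      by (metis ST TS bounded_clinear_scaleC[OF T(1)])
    show "norm (inv T x) \<le> c * norm x" for x using c[of "inv T x"] TS by simp
  qed
  then show "invertible_op T"
    using T ST TS by (auto simp: invertible_op_def fun_eq_iff intro!: exI[of _ "inv T"])
qed

lemma invertible_op_inv:
  assumes "invertible_op T"
  shows "T (inv T x) = x" "inv T (T x) = x" "invertible_op (inv T)" "inv (inv T) = T"
proof -
  obtain S where S: "bounded_clinear T" "bounded_clinear S" "S \<circ> T = id" "T \<circ> S = id"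
    using assms by (auto simp: invertible_op_def)
  then have "inv T = S" "inv S = T" by (auto intro: inv_unique_comp)
  then show "inv (inv T) = T" by metis
  show "T (inv T x) = x" "inv T (T x) = x" "invertible_op (inv T)"
    unfolding \<open>inv T = S\<close> using S by (auto simp: fun_eq_iff invertible_op_def)
qed

lemma invertible_op_bounded_clinear: "invertible_op T \<Longrightarrow> bounded_clinear T"
  by (simp add: invertible_op_def)

lemma invertible_op_compose:
  assumes "invertible_op S" "invertible_op T"
  shows "invertible_op (\<lambda>x. S (T x))"
  unfolding invertible_op_def
proof (intro conjI exI)
  note inv = invertible_op_inv[OF assms(1)] invertible_op_inv[OF assms(2)]
  show "bounded_clinear (\<lambda>x. S (T x))"
    using assms by (intro bounded_clinear_compose[of S T] invertible_op_bounded_clinear)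
  show "bounded_clinear (\<lambda>x. inv T (inv S x))"
    using inv(3,7) by (intro bounded_clinear_compose[of "inv T" "inv S"] invertible_op_bounded_clinear)
  show "(\<lambda>x. inv T (inv S x)) \<circ> (\<lambda>x. S (T x)) = id" "(\<lambda>x. S (T x)) \<circ> (\<lambda>x. inv T (inv S x)) = id"
    by (simp_all add: fun_eq_iff inv(1,2,5,6))
qed

lemma invertible_op_scaleC:
  assumes "c \<noteq> 0" "invertible_op T"
  shows "invertible_op (\<lambda>x. c *\<^sub>C T x)"
proof (rule invertible_op_compose[of "scaleC c", OF _ assms(2)])
  show "invertible_op (scaleC c :: 'a \<Rightarrow> 'a)"
    unfolding invertible_op_def using assms
    by (intro conjI exI[of _ "scaleC (inverse c)"])
      (auto simp: fun_eq_iff scaleC_scaleC intro!: bounded_clinear_scaleC_right bounded_clinear_ident)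
qed

lemma invertible_op_ident: "invertible_op (\<lambda>x. x)"
  unfolding invertible_op_def by (intro conjI exI[of _ "\<lambda>x. x"]) (auto intro: bounded_clinear_ident)

lemma invertible_op_commuting_factor:
  assumes U: "bounded_clinear U" and V: "bounded_clinear V"
    and comm: "\<And>x. U (V x) = V (U x)" and UV: "invertible_op (\<lambda>x. U (V x))"
  shows "invertible_op V"
  unfolding invertible_op_iff
proof (intro conjI)
  show "bounded_clinear V" by (rule V)
  have "surj (\<lambda>x. V (U x))" using UV comm by (simp add: invertible_op_iff)
  then show "surj V" unfolding surj_def by metis
  obtain c where c: "\<And>x. norm x \<le> c * norm (U (V x))"
    using UV by (auto simp: invertible_op_iff)
  obtain K where K: "0 < K" "\<And>x. norm (U x) \<le> K * norm x" using bounded_clinear_boundE[OF U] by blast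
  have "norm x \<le> (\<bar>c\<bar> * K) * norm (V x)" for x
  proof -
    have "norm x \<le> \<bar>c\<bar> * norm (U (V x))"
      using c[of x] by (meson abs_ge_self mult_right_mono norm_ge_zero order_trans)
    also have "\<dots> \<le> \<bar>c\<bar> * (K * norm (V x))" using K by (intro mult_left_mono) auto
    finally show ?thesis by simp
  qed
  then show "\<exists>c. \<forall>x. norm x \<le> c * norm (V x)" by blast
qed

text \<open>Replaces the Neumann series: \<open>G x = y\<close> says that \<open>x\<close> is a
  fixed point of the contraction sending \<open>x\<close> to \<open>y + x - G x\<close>. The lower
  bound is the triangle inequality.\<close>

lemma invertible_op_near_ident:
  fixes G :: "'a::complex_banach \<Rightarrow> 'a"
  assumes G: "bounded_clinear G" and c: "c < 1" "\<And>x. norm (G x - x) \<le> c * norm x"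
  shows "invertible_op G"
  unfolding invertible_op_iff
proof (intro conjI)
  \<comment> \<open>Nothing forces \<open>c\<close> to be nonnegative, as a contraction constant
    must be.\<close>
  define c' where "c' = max c 0"
  have c': "0 \<le> c'" "c' < 1" "\<And>x. norm (G x - x) \<le> c' * norm x"
    using c order_trans[OF c(2) mult_right_mono[of c c']] by (auto simp: c'_def)
  show "surj G"
  proof (rule surjI)
    fix y
    have "dist (y + x - G x) (y + x' - G x') \<le> c' * dist x x'" for x x'
    proof -
      have "dist (y + x - G x) (y + x' - G x') = norm (G (x - x') - (x - x'))"
        by (simp add: dist_norm bounded_clinear_diff[OF G] norm_minus_commute algebra_simps)
      then show ?thesis using c'(3)[of "x - x'"] by (simp add: dist_norm)
    qed
    then have "\<exists>!x. y + x - G x = x"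
      by (intro banach_fix_type[OF c'(1,2)]) auto
    then have "\<exists>x. G x = y" by (auto simp: algebra_simps)
    then show "G (SOME x. G x = y) = y" by (rule someI_ex)
  qed
  have "norm x \<le> 1 / (1 - c') * norm (G x)" for x
  proof -
    have "norm x \<le> norm (G x) + norm (G x - x)" by norm
    then have "(1 - c') * norm x \<le> norm (G x)" using c'(3)[of x] by (simp add: algebra_simps)
    then show ?thesis using c' by (simp add: field_simps)
  qed
  then show "\<exists>c. \<forall>x. norm x \<le> c * norm (G x)" by blast
qed fact

section \<open>Compactness of the spectrum and uniform resolvent bounds\<close>

lemma not_in_op_spectrum_iff: "z \<notin> op_spectrum T \<longleftrightarrow> invertible_op (\<lambda>x. z *\<^sub>C x - T x)"
  by (simp add: op_spectrum_def)

lemma resolvent_boundE: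
  assumes "z \<notin> op_spectrum T"
  obtains c where "0 < c" "\<And>x. norm x \<le> c * norm (z *\<^sub>C x - T x)"
proof -
  obtain c where c: "\<And>x. norm x \<le> c * norm (z *\<^sub>C x - T x)"
    using assms by (auto simp: not_in_op_spectrum_iff invertible_op_iff)
  have "norm x \<le> max c 1 * norm (z *\<^sub>C x - T x)" for x
    using c[of x] by (rule order_trans) (auto intro!: mult_right_mono)
  then show ?thesis using that[of "max c 1"] by simp
qed

text \<open>With \<open>V = z - T\<close> invertible, \<open>w - T\<close> factors as
  \<open>(1 + (w - z) V^-1) V\<close>, whose first factor is near the identity when \<open>w\<close>
  is near \<open>z\<close>.\<close>

lemma closed_op_spectrum:
  fixes T :: "'a::complex_banach \<Rightarrow> 'a"
  shows "closed (op_spectrum T)"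
  unfolding closed_def open_contains_ball
proof
  fix z assume "z \<in> - op_spectrum T"
  then have z: "z \<notin> op_spectrum T" by simp
  then obtain c where c: "0 < c" "\<And>x. norm x \<le> c * norm (z *\<^sub>C x - T x)"
    using resolvent_boundE by blast
  let ?V = "\<lambda>x. z *\<^sub>C x - T x"
  have V: "invertible_op ?V" using z by (simp add: not_in_op_spectrum_iff)
  have "w \<notin> op_spectrum T" if "cmod (z - w) < 1 / c" for w
  proof -
    define G where "G y = y + (w - z) *\<^sub>C inv ?V y" for y
    have "bounded_clinear (inv ?V)"
      using invertible_op_inv(3)[OF V] by (rule invertible_op_bounded_clinear)
    then have "bounded_clinear G" unfolding G_def by (intro bounded_clinear_intros)
    moreover have "norm (G y - y) \<le> (cmod (z - w) * c) * norm y" for y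
    proof -
      have "norm (inv ?V y) \<le> c * norm y"
        using c(2)[of "inv ?V y"] invertible_op_inv(1)[OF V, of y] by simp
      then show ?thesis
        by (simp add: G_def norm_scaleC norm_minus_commute mult.assoc mult_left_mono)
    qed
    moreover have "cmod (z - w) * c < 1" using that c(1) by (simp add: field_simps)
    ultimately have "invertible_op G" by (intro invertible_op_near_ident)
    then have "invertible_op (\<lambda>x. G (?V x))" using V by (rule invertible_op_compose)
    moreover have "G (?V x) = w *\<^sub>C x - T x" for x
      using invertible_op_inv(2)[OF V, of x]
      by (simp add: G_def complex_vector.scale_left_diff_distrib)
    ultimately show ?thesis by (simp add: not_in_op_spectrum_iff)
  qed
  then show "\<exists>e>0. ball z e \<subseteq> - op_spectrum T"
    using c(1) by (intro exI[of _ "1 / c"]) (auto simp: dist_norm)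
qed

text \<open>Boundedness: if \<open>cmod z\<close> exceeds a norm bound of \<open>T\<close>, then
  \<open>1 - T / z\<close> is near the identity.\<close>

lemma compact_op_spectrum:
  fixes T :: "'a::complex_banach \<Rightarrow> 'a"
  assumes T: "bounded_clinear T"
  shows "compact (op_spectrum T)"
proof -
  obtain K where K: "0 < K" "\<And>x. norm (T x) \<le> K * norm x" using bounded_clinear_boundE[OF T] by blast
  have "cmod z \<le> K" if "z \<in> op_spectrum T" for z
  proof (rule ccontr)
    assume "\<not> cmod z \<le> K"
    then have z: "K < cmod z" "z \<noteq> 0" using K(1) by auto
    define G where "G x = x - inverse z *\<^sub>C T x" for x
    have "bounded_clinear G" unfolding G_def using T by (intro bounded_clinear_intros)
    moreover have "norm (G x - x) \<le> (K / cmod z) * norm x" for x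
      using mult_left_mono[OF K(2)[of x], of "inverse (cmod z)"]
      by (simp add: G_def norm_scaleC norm_inverse divide_inverse mult_ac)
    moreover have "K / cmod z < 1" using z K by (simp add: field_simps)
    ultimately have "invertible_op G" by (intro invertible_op_near_ident)
    then have "invertible_op (\<lambda>x. z *\<^sub>C G x)" using z(2) by (intro invertible_op_scaleC)
    moreover have "z *\<^sub>C G x = z *\<^sub>C x - T x" for x
      using z(2) by (simp add: G_def complex_vector.scale_right_diff_distrib)
    ultimately show False using that by (simp add: op_spectrum_def)
  qed
  then have "bounded (op_spectrum T)" by (auto simp: bounded_iff)
  then show ?thesis by (simp add: compact_eq_bounded_closed closed_op_spectrum)
qed

text \<open>On the ball of radius \<open>1 / (2 * c z)\<close> around \<open>z\<close> the constant
  at most doubles, so finitely many balls give a common bound.\<close>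

lemma resolvent_bound_compact:
  assumes "compact Z" "Z \<inter> op_spectrum T = {}"
  obtains M where "0 < M" "\<And>z x. z \<in> Z \<Longrightarrow> norm x \<le> M * norm (z *\<^sub>C x - T x)"
proof -
  have "\<exists>c. 0 < c \<and> (\<forall>x. norm x \<le> c * norm (z *\<^sub>C x - T x))" if "z \<in> Z" for z
    using resolvent_boundE[of z T] assms(2) that by blast
  then obtain c where c: "\<And>z. z \<in> Z \<Longrightarrow> 0 < c z"
      "\<And>z x. z \<in> Z \<Longrightarrow> norm x \<le> c z * norm (z *\<^sub>C x - T x)"
    by metis
  have cover: "Z \<subseteq> (\<Union>z\<in>Z. ball z (1 / (2 * c z)))"
    using c(1) by fastforce
  obtain C where C: "C \<subseteq> Z" "finite C" "Z \<subseteq> (\<Union>z\<in>C. ball z (1 / (2 * c z)))"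
    by (rule compactE_image[OF assms(1) _ cover]) auto
  \<comment> \<open>The sum is a crude maximum; the 1 keeps \<open>M\<close> positive when
    \<open>C\<close> is empty.\<close>
  define M where "M = 1 + (\<Sum>z\<in>C. 2 * c z)"
  have M: "2 * c z \<le> M" if "z \<in> C" for z
    using member_le_sum[of z C "\<lambda>z. 2 * c z"] that C c(1) by (force simp: M_def subset_iff less_imp_le)
  have "norm x \<le> M * norm (w *\<^sub>C x - T x)" if "w \<in> Z" for w x
  proof -
    obtain z where z: "z \<in> C" "dist z w < 1 / (2 * c z)" using C(3) \<open>w \<in> Z\<close> by auto
    have cz: "0 < c z" using z C c(1) by auto
    have "norm x \<le> c z * norm (z *\<^sub>C x - T x)" using z C c(2) by auto
    also have "z *\<^sub>C x - T x = (w *\<^sub>C x - T x) + (z - w) *\<^sub>C x"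
      by (simp add: complex_vector.scale_left_diff_distrib)
    also have "norm \<dots> \<le> norm (w *\<^sub>C x - T x) + 1 / (2 * c z) * norm x"
      using mult_right_mono[OF less_imp_le[OF z(2)] norm_ge_zero[of x]]
      by (intro norm_triangle_le add_left_mono) (simp add: norm_scaleC dist_norm)
    also have "c z * \<dots> = c z * norm (w *\<^sub>C x - T x) + norm x / 2"
      using cz by (simp add: field_simps)
    finally have "norm x \<le> (2 * c z) * norm (w *\<^sub>C x - T x)" using cz by simp
    also have "\<dots> \<le> M * norm (w *\<^sub>C x - T x)" using M[OF z(1)] by (intro mult_right_mono) auto
    finally show ?thesis .
  qed
  moreover have "0 < M" using C c(1) unfolding M_def
    by (intro add_pos_nonneg sum_nonneg) (auto simp: subset_iff less_imp_le)
  ultimately show ?thesis using that by blast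
qed

section \<open>Averaging the resolvent over roots of unity\<close>

lemma telescope_power_diff:
  assumes T: "bounded_clinear T"
  shows "(\<Sum>j<n. (z ^ (n - Suc j)) *\<^sub>C (T ^^ j) (z *\<^sub>C y - T y)) = z ^ n *\<^sub>C y - (T ^^ n) y"
proof (induction n)
  case (Suc n)
  have "(\<Sum>j<n. (z ^ (Suc n - Suc j)) *\<^sub>C (T ^^ j) (z *\<^sub>C y - T y))
      = z *\<^sub>C (\<Sum>j<n. (z ^ (n - Suc j)) *\<^sub>C (T ^^ j) (z *\<^sub>C y - T y))"
    unfolding complex_vector.scale_sum_right
    by (intro sum.cong refl) (simp add: scaleC_scaleC Suc_diff_Suc flip: power_Suc)
  moreover have "(T ^^ n) (z *\<^sub>C y - T y) = z *\<^sub>C (T ^^ n) y - (T ^^ Suc n) y"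
    by (simp add: bounded_clinear_diff[OF bounded_clinear_funpow[OF T]]
        bounded_clinear_scaleC[OF bounded_clinear_funpow[OF T]] funpow_swap1)
  ultimately show ?case
    by (simp add: Suc.IH complex_vector.scale_right_diff_distrib scaleC_scaleC)
qed simp

lemma sum_root_of_unity_powers:
  assumes "0 < n"
  obtains w :: complex where "cmod w = 1" "w ^ n = 1"
    "\<And>m. 0 < m \<Longrightarrow> m < n \<Longrightarrow> (\<Sum>k<n. (w ^ k) ^ m) = 0"
proof
  define w where "w = exp (2 * of_real pi * \<i> * of_nat 1 / of_nat n)"
  show "w ^ n = 1" using complex_root_unity[of n 1] assms by (simp add: w_def)
  then show "cmod w = 1" using assms by (metis power_eq_1_iff order_less_imp_not_eq2)
  fix m assume m: "0 < m" "m < n"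
  have "w ^ m = exp (2 * of_real pi * \<i> * of_nat m / of_nat n)"
    by (simp add: w_def exp_of_nat_mult[symmetric] mult_ac)
  then have "w ^ m \<noteq> 1" using complex_root_unity_eq_1[of n m] m assms by (auto dest: dvd_imp_le)
  have "(\<Sum>k<n. (w ^ k) ^ m) = (\<Sum>k<n. (w ^ m) ^ k)"
    by (simp flip: power_mult add: mult.commute)
  also have "\<dots> = ((w ^ m) ^ n - 1) / (w ^ m - 1)" using \<open>w ^ m \<noteq> 1\<close> by (rule geometric_sum)
  also have "(w ^ m) ^ n = 1" using \<open>w ^ n = 1\<close> by (metis mult.commute power_mult power_one)
  finally show "(\<Sum>k<n. (w ^ k) ^ m) = 0" by simp
qed

text \<open>The \<open>y k\<close> are the resolvent values at the points \<open>c * w ^ k\<close>,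
  all with the same \<open>n\<close>-th power \<open>c ^ n\<close>. Telescoping turns
  \<open>c ^ n - T ^ n\<close>, applied to the \<open>k\<close>-th summand, into a polynomial in
  \<open>T\<close> applied to \<open>x\<close>; the sum over \<open>k\<close> leaves only its
  constant term.\<close>

lemma resolvent_average:
  assumes T: "bounded_clinear T" and n: "0 < n" and w: "w ^ n = 1"
    "\<And>m. 0 < m \<Longrightarrow> m < n \<Longrightarrow> (\<Sum>k<n. (w ^ k) ^ m) = 0"
    and y: "\<And>k. (c * w ^ k) *\<^sub>C y k - T (y k) = x"
    and f: "f = (1 / of_nat n) *\<^sub>C (\<Sum>k<n. (c * w ^ k) *\<^sub>C y k)"
  shows "c ^ n *\<^sub>C f - (T ^^ n) f = c ^ n *\<^sub>C x"
proof -
  note Tn = bounded_clinear_funpow[OF T, of n]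
  have "(c ^ n) *\<^sub>C ((c * w ^ k) *\<^sub>C y k) - (T ^^ n) ((c * w ^ k) *\<^sub>C y k)
      = (\<Sum>j<n. (c ^ (n - j) * (w ^ k) ^ (n - j)) *\<^sub>C (T ^^ j) x)" for k
  proof -
    have "(w ^ k) ^ n = 1" using w(1) by (metis mult.commute power_mult power_one)
    then have "(c * w ^ k) ^ n = c ^ n" by (simp add: power_mult_distrib)
    then have "(c ^ n) *\<^sub>C ((c * w ^ k) *\<^sub>C y k) - (T ^^ n) ((c * w ^ k) *\<^sub>C y k)
      = (c * w ^ k) *\<^sub>C ((c * w ^ k) ^ n *\<^sub>C y k - (T ^^ n) (y k))"
      by (simp add: bounded_clinear_scaleC[OF Tn] complex_vector.scale_right_diff_distrib
          scaleC_scaleC mult.commute)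
    also have "\<dots> = (\<Sum>j<n. ((c * w ^ k) * (c * w ^ k) ^ (n - Suc j)) *\<^sub>C (T ^^ j) x)"
      by (simp only: telescope_power_diff[OF T, symmetric] y complex_vector.scale_sum_right scaleC_scaleC)
    also have "\<dots> = (\<Sum>j<n. (c ^ (n - j) * (w ^ k) ^ (n - j)) *\<^sub>C (T ^^ j) x)"
      by (intro sum.cong refl) (simp add: Suc_diff_Suc flip: power_Suc power_mult_distrib)
    finally show ?thesis .
  qed
  note each = this
  have "c ^ n *\<^sub>C f = (1 / of_nat n) *\<^sub>C (\<Sum>k<n. c ^ n *\<^sub>C ((c * w ^ k) *\<^sub>C y k))"
    by (simp only: f complex_vector.scale_left_commute[of "c ^ n"] complex_vector.scale_sum_right[of "c ^ n"])
  moreover have "(T ^^ n) f = (1 / of_nat n) *\<^sub>C (\<Sum>k<n. (T ^^ n) ((c * w ^ k) *\<^sub>C y k))"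
    by (simp only: f bounded_clinear_scaleC[OF Tn, of "1 / of_nat n"] bounded_clinear_sum[OF Tn])
  ultimately have "c ^ n *\<^sub>C f - (T ^^ n) f = (1 / of_nat n) *\<^sub>C
      (\<Sum>k<n. \<Sum>j<n. (c ^ (n - j) * (w ^ k) ^ (n - j)) *\<^sub>C (T ^^ j) x)"
    by (simp only: complex_vector.scale_right_diff_distrib[symmetric] sum_subtractf[symmetric] each)
  also have "(\<Sum>k<n. \<Sum>j<n. (c ^ (n - j) * (w ^ k) ^ (n - j)) *\<^sub>C (T ^^ j) x)
      = (\<Sum>j<n. (c ^ (n - j) * (\<Sum>k<n. (w ^ k) ^ (n - j))) *\<^sub>C (T ^^ j) x)"
    by (subst sum.swap) (simp add: sum_distrib_left complex_vector.scale_sum_left)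
  \<comment> \<open>For \<open>0 < j\<close> the exponent \<open>n - j\<close> lies strictly between
    0 and \<open>n\<close> and the root sum vanishes; at \<open>j = 0\<close> every summand is
    1.\<close>
  also have "\<dots> = (\<Sum>j<n. if j = 0 then (c ^ n * of_nat n) *\<^sub>C x else 0)"
  proof (intro sum.cong refl)
    fix j assume "j \<in> {..<n}"
    moreover have "(w ^ k) ^ n = 1" for k
      using w(1) by (metis mult.commute power_mult power_one)
    ultimately show "(c ^ (n - j) * (\<Sum>k<n. (w ^ k) ^ (n - j))) *\<^sub>C (T ^^ j) x
        = (if j = 0 then (c ^ n * of_nat n) *\<^sub>C x else 0)"
      using w(2)[of "n - j"] by auto
  qed
  also have "\<dots> = (c ^ n * of_nat n) *\<^sub>C x" using n by simp
  finally show ?thesis using n by (simp add: scaleC_scaleC)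
qed

lemma norm_average_le:
  fixes v :: "nat \<Rightarrow> 'a::complex_normed_vector"
  assumes "0 < n" "\<And>k. norm (v k) \<le> B"
  shows "norm ((1 / of_nat n) *\<^sub>C (\<Sum>k<n. v k)) \<le> B"
proof -
  have "norm (\<Sum>k<n. v k) \<le> of_nat n * B"
    using sum_norm_le[of "{..<n}" v "\<lambda>_. B"] assms(2) by simp
  then show ?thesis using assms(1) by (simp add: norm_scaleC norm_divide field_simps)
qed

section \<open>Nonemptiness of the spectrum\<close>

lemma op_spectrum_nonempty:
  fixes T :: "'a::complex_banach \<Rightarrow> 'a"
  assumes T: "bounded_clinear T" and nontriv: "\<exists>x::'a. x \<noteq> 0"
  shows "op_spectrum T \<noteq> {}"
proof
  assume empty: "op_spectrum T = {}"
  obtain x0 :: 'a where "x0 \<noteq> 0" using nontriv by blast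
  obtain C where C: "0 < C" "\<And>x. norm (T x) \<le> C * norm x" using bounded_clinear_boundE[OF T] by blast
  \<comment> \<open>The infimum of \<open>S\<close> is the quantity in Gelfand's formula, written
    without an operator norm.\<close>
  define S where "S = {s. 0 < s \<and> (\<exists>n>0. \<forall>x. norm ((T ^^ n) x) \<le> s ^ n * norm x)}"
  define \<rho> where "\<rho> = Inf S"
  have "C \<in> S" unfolding S_def using C by (auto intro!: exI[of _ "1::nat"])
  have bdd: "bdd_below S" by (rule bdd_belowI[of _ 0]) (auto simp: S_def)
  \<comment> \<open>Since 0 is outside the spectrum, \<open>T\<close> is bounded below by
    \<open>1 / c\<close>, which on \<open>x0\<close> prevents its powers from decaying faster than
    \<open>(1 / c) ^ n\<close>.\<close>
  have "0 < \<rho>"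
  proof -
    obtain c where c: "0 < c" "\<And>x. norm x \<le> c * norm (0 *\<^sub>C x - T x)"
      using resolvent_boundE[of 0 T] empty by auto
    have pow: "norm x \<le> c ^ n * norm ((T ^^ n) x)" for x n
    proof (induction n)
      case (Suc n)
      have "c ^ n * norm ((T ^^ n) x) \<le> c ^ n * (c * norm (T ((T ^^ n) x)))"
        using c(2)[of "(T ^^ n) x"] c(1) by (intro mult_left_mono) auto
      then show ?case using Suc by (simp add: mult_ac)
    qed simp
    have "1 / c \<le> s" if s: "s \<in> S" for s
    proof -
      obtain n where n: "0 < n" "0 < s" "\<And>x. norm ((T ^^ n) x) \<le> s ^ n * norm x"
        using s by (auto simp: S_def)
      have "norm x0 \<le> c ^ n * (s ^ n * norm x0)"
        using pow[of x0 n] n(3)[of x0] c(1) by (meson mult_left_mono order_trans zero_le_power less_imp_le)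
      then have "1 \<le> (c * s) ^ n" using \<open>x0 \<noteq> 0\<close> by (simp add: power_mult_distrib)
      then have "1 \<le> c * s" using n c(1) by (metis not_le mult_pos_pos less_imp_le power_less_one_iff)
      then show ?thesis using c(1) by (simp add: field_simps)
    qed
    then have "1 / c \<le> \<rho>" unfolding \<rho>_def using \<open>C \<in> S\<close> by (intro cInf_greatest) auto
    then show ?thesis using c(1) by (meson less_le_trans zero_less_divide_1_iff)
  qed
  \<comment> \<open>This disc contains the circles of radius \<open>\<rho>\<close> and
    \<open>r\<close>, because \<open>\<delta> \<le> 1\<close>.\<close>
  obtain M where M: "0 < M" "\<And>z x. z \<in> cball 0 (\<rho> + 1) \<Longrightarrow> norm x \<le> M * norm (z *\<^sub>C x - T x)"
    using resolvent_bound_compact[of "cball 0 (\<rho> + 1)" T] empty by auto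
  define R where "R z = inv (\<lambda>x. z *\<^sub>C x - T x)" for z
  have inv_R: "invertible_op (\<lambda>x. z *\<^sub>C x - T x)" for z
    using empty not_in_op_spectrum_iff by blast
  have R: "z *\<^sub>C R z x - T (R z x) = x" for z x
    unfolding R_def by (rule invertible_op_inv(1)[OF inv_R])
  have R_bcl: "bounded_clinear (R z)" for z
    unfolding R_def by (intro invertible_op_bounded_clinear invertible_op_inv(3) inv_R)
  have R_le: "norm (R z x) \<le> M * norm x" if "cmod z \<le> \<rho> + 1" for z x
    using M(2)[of z "R z x"] that by (simp add: R)
  \<comment> \<open>\<open>z R z = 1 + T R z\<close>, so the difference is \<open>T\<close> applied
    to a difference of resolvents, and the resolvent identity bounds the latter with two factors
    \<open>M\<close>.\<close>
  have lipschitz: "norm (z *\<^sub>C R z x - z' *\<^sub>C R z' x) \<le> C * M\<^sup>2 * cmod (z - z') * norm x"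
    if "cmod z \<le> \<rho> + 1" "cmod z' \<le> \<rho> + 1" for z z' x
  proof -
    have "z *\<^sub>C (R z x - R z' x) - T (R z x - R z' x)
        = (z *\<^sub>C R z x - T (R z x)) - (z' *\<^sub>C R z' x - T (R z' x)) + (z' - z) *\<^sub>C R z' x"
      by (simp add: bounded_clinear_diff[OF T] complex_vector.scale_right_diff_distrib
          complex_vector.scale_left_diff_distrib)
    also have "\<dots> = (z' - z) *\<^sub>C R z' x" by (simp add: R)
    finally have "norm (R z x - R z' x) \<le> M * (cmod (z - z') * norm (R z' x))"
      using M(2)[of z "R z x - R z' x"] that by (simp add: norm_scaleC norm_minus_commute)
    also have "\<dots> \<le> M * (cmod (z - z') * (M * norm x))"
      using R_le[OF that(2)] M(1) by (intro mult_left_mono) auto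
    finally have "C * norm (R z x - R z' x) \<le> C * (M * (cmod (z - z') * (M * norm x)))"
      using C(1) by (intro mult_left_mono) auto
    moreover have "z *\<^sub>C R z x - z' *\<^sub>C R z' x = T (R z x - R z' x)"
      using R[of z x] R[of z' x] by (simp add: bounded_clinear_diff[OF T] algebra_simps)
    ultimately show ?thesis
      using C(2)[of "R z x - R z' x"] by (simp add: power2_eq_square mult_ac)
  qed
  define \<delta> where "\<delta> = 1 / (4 * C * M\<^sup>2 + 1)"
  define r where "r = \<rho> + \<delta>"
  have \<delta>: "0 < \<delta>" "\<delta> \<le> 1" "C * M\<^sup>2 * \<delta> \<le> 1 / 4"
    using C(1) M(1) by (auto simp: \<delta>_def field_simps add_pos_pos)
  then have "\<rho> < r" by (simp add: r_def)
  then obtain s where s: "s \<in> S" "s < r"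
    unfolding \<rho>_def using cInf_less_iff[OF _ bdd] \<open>C \<in> S\<close> by blast
  obtain n0 where n0: "0 < n0" "0 < s" "\<And>x. norm ((T ^^ n0) x) \<le> s ^ n0 * norm x"
    using s(1) by (auto simp: S_def)
  have "(s / r) ^ n0 < 1" using n0 s \<open>0 < \<rho>\<close> \<open>\<rho> < r\<close> by (simp add: power_less_one_iff)
  \<comment> \<open>The 1/9 becomes 1/8 in \<open>f_r\<close>; with the 1/4 from
    \<open>\<delta>\<close> this makes 3/8 in \<open>f_\<rho>\<close>, and finally 3/5. Exponents
    are multiples of \<open>n0\<close> because only there the bound by \<open>s\<close> is
    known.\<close>
  then obtain k where k: "((s / r) ^ n0) ^ k < 1 / 9"
    using real_arch_pow_inv[of "1 / 9" "(s / r) ^ n0"] by auto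
  define n where "n = n0 * k"
  have "0 < k" using k by (cases k) auto
  then have "0 < n" using n0 by (simp add: n_def)
  have "norm ((T ^^ (n0 * i)) x) \<le> s ^ (n0 * i) * norm x" for i x
  proof (induction i)
    case (Suc i)
    have "norm ((T ^^ n0) ((T ^^ (n0 * i)) x)) \<le> s ^ n0 * (s ^ (n0 * i) * norm x)"
      using n0(2) by (intro order_trans[OF n0(3)] mult_left_mono Suc) auto
    then show ?case by (simp add: funpow_add power_add mult_ac)
  qed simp
  moreover have "s ^ n \<le> r ^ n / 9"
    using k \<open>0 < \<rho>\<close> \<open>\<rho> < r\<close> by (simp add: n_def field_simps flip: power_mult)
  ultimately have Tn_r: "norm ((T ^^ n) x) \<le> r ^ n / 9 * norm x" for x
    unfolding n_def by (meson mult_right_mono norm_ge_zero order_trans)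
  obtain w :: complex where w: "cmod w = 1" "w ^ n = 1"
    "\<And>m. 0 < m \<Longrightarrow> m < n \<Longrightarrow> (\<Sum>k<n. (w ^ k) ^ m) = 0"
    using sum_root_of_unity_powers[OF \<open>0 < n\<close>] by blast
  define f where "f t x = (1 / of_nat n) *\<^sub>C
      (\<Sum>k<n. (complex_of_real t * w ^ k) *\<^sub>C R (complex_of_real t * w ^ k) x)" for t :: real and x
  \<comment> \<open>In this form, closeness of \<open>f t\<close> to the identity amounts to
    smallness of \<open>T ^^ n\<close> on the range of \<open>f t\<close>.\<close>
  have f: "complex_of_real (t ^ n) *\<^sub>C (f t x - x) = (T ^^ n) (f t x)" for t x
    using resolvent_average[OF T \<open>0 < n\<close> w(2,3) R f_def]
    by (simp add: complex_vector.scale_right_diff_distrib algebra_simps)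
  have f_r: "norm (f r x - x) \<le> norm x / 8" for x
  proof -
    have "r ^ n * norm (f r x - x) \<le> r ^ n * (norm (f r x) / 9)"
      using Tn_r[of "f r x"] \<open>0 < \<rho>\<close> \<open>\<rho> < r\<close> arg_cong[OF f[of r x], of norm]
      by (simp add: norm_scaleC norm_power)
    then have "norm (f r x - x) \<le> norm (f r x) / 9" using \<open>0 < \<rho>\<close> \<open>\<rho> < r\<close> by simp
    moreover have "norm (f r x) \<le> norm (f r x - x) + norm x" by norm
    ultimately show ?thesis by simp
  qed
  \<comment> \<open>Corresponding nodes on the two circles are at distance \<open>\<delta>\<close>
    for every \<open>k\<close>. The estimate is thus independent of \<open>n\<close>, which was
    chosen after \<open>\<delta>\<close>.\<close>
  have f_diff: "norm (f \<rho> x - f r x) \<le> norm x / 4" for x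
  proof -
    have "f \<rho> x - f r x = (1 / of_nat n) *\<^sub>C
        (\<Sum>k<n. (complex_of_real \<rho> * w ^ k) *\<^sub>C R (complex_of_real \<rho> * w ^ k) x
           - (complex_of_real r * w ^ k) *\<^sub>C R (complex_of_real r * w ^ k) x)"
      by (simp add: f_def complex_vector.scale_right_diff_distrib sum_subtractf)
    also have "norm \<dots> \<le> norm x / 4"
    proof (rule norm_average_le[OF \<open>0 < n\<close>])
      fix k
      have cmod_w: "cmod (complex_of_real t * w ^ k) = \<bar>t\<bar>" for t
        by (simp add: norm_mult norm_power w(1))
      have "norm ((complex_of_real \<rho> * w ^ k) *\<^sub>C R (complex_of_real \<rho> * w ^ k) x
           - (complex_of_real r * w ^ k) *\<^sub>C R (complex_of_real r * w ^ k) x)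
        \<le> C * M\<^sup>2 * cmod (complex_of_real \<rho> * w ^ k - complex_of_real r * w ^ k) * norm x"
        using \<delta> \<open>0 < \<rho>\<close> by (intro lipschitz) (simp_all add: cmod_w, simp add: r_def)
      also have "cmod (complex_of_real \<rho> * w ^ k - complex_of_real r * w ^ k) = \<delta>"
        using \<delta>(1) by (simp add: norm_mult norm_power w(1) r_def flip: left_diff_distrib of_real_diff)
      also have "C * M\<^sup>2 * \<delta> * norm x \<le> 1 / 4 * norm x" using \<delta>(3) by (intro mult_right_mono) auto
      finally show "norm ((complex_of_real \<rho> * w ^ k) *\<^sub>C R (complex_of_real \<rho> * w ^ k) x
           - (complex_of_real r * w ^ k) *\<^sub>C R (complex_of_real r * w ^ k) x) \<le> norm x / 4" by simp
    qed
    finally show ?thesis .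
  qed
  have f_\<rho>: "norm (f \<rho> x - x) \<le> 3 / 8 * norm x" for x
  proof -
    have "norm (f \<rho> x - x) \<le> norm (f \<rho> x - f r x) + norm (f r x - x)" by norm
    then show ?thesis using f_r[of x] f_diff[of x] by simp
  qed
  have "bounded_clinear (f \<rho>)"
    unfolding f_def by (intro bounded_clinear_intros R_bcl)
  then have "invertible_op (f \<rho>)" by (rule invertible_op_near_ident[OF _ _ f_\<rho>]) simp
  then have "surj (f \<rho>)" by (simp add: invertible_op_iff)
  \<comment> \<open>Surjectivity of \<open>f \<rho>\<close> extends the bound from its range to all
    vectors; \<open>norm x \<le> 8/5 * norm (f \<rho> x)\<close> turns 3/8 into 3/5.\<close>
  have Tn_\<rho>: "norm ((T ^^ n) y) \<le> 3 / 5 * \<rho> ^ n * norm y" for y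
  proof -
    obtain x where x: "y = f \<rho> x" using \<open>surj (f \<rho>)\<close> by (metis surj_def)
    have "norm x \<le> norm (f \<rho> x) + norm (f \<rho> x - x)" by norm
    then have "norm (f \<rho> x - x) \<le> 3 / 5 * norm (f \<rho> x)" using f_\<rho>[of x] by simp
    then have "\<rho> ^ n * norm (f \<rho> x - x) \<le> \<rho> ^ n * (3 / 5 * norm (f \<rho> x))"
      using \<open>0 < \<rho>\<close> by (intro mult_left_mono) auto
    moreover have "\<rho> ^ n * norm (f \<rho> x - x) = norm ((T ^^ n) (f \<rho> x))"
      using \<open>0 < \<rho>\<close> arg_cong[OF f[of \<rho> x], of norm] by (simp add: norm_scaleC norm_power)
    ultimately show ?thesis unfolding x by (simp only: mult_ac)
  qed
  \<comment> \<open>Taking the \<open>n\<close>-th root of 3/5 gives an element of \<open>S\<close>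
    strictly below its infimum.\<close>
  define s' where "s' = root n (3 / 5) * \<rho>"
  have "s' ^ n = 3 / 5 * \<rho> ^ n" using \<open>0 < n\<close> by (simp add: s'_def power_mult_distrib)
  then have "norm ((T ^^ n) y) \<le> s' ^ n * norm y" for y using Tn_\<rho>[of y] by (simp only:)
  moreover have "0 < s'" using \<open>0 < n\<close> \<open>0 < \<rho>\<close> by (simp add: s'_def)
  ultimately have "s' \<in> S" unfolding S_def using \<open>0 < n\<close> by blast
  then have "\<rho> \<le> s'" unfolding \<rho>_def using bdd by (intro cInf_lower)
  moreover have "root n (3 / 5) < 1" using \<open>0 < n\<close> by simp
  ultimately show False using \<open>0 < \<rho>\<close> by (simp add: s'_def)
qed

section \<open>Spectral mapping for polynomials and inverses\<close>

text \<open>A common summation bound is what allows polynomials of different degrees to be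
  added.\<close>

lemma poly_op_eq_sum:
  assumes "degree p \<le> N"
  shows "poly_op p T x = (\<Sum>i\<le>N. coeff p i *\<^sub>C (T ^^ i) x)"
  unfolding poly_op_def using assms
  by (intro sum.mono_neutral_left) (auto simp: coeff_eq_0)

lemma poly_op_0 [simp]: "poly_op 0 T x = 0"
  by (simp add: poly_op_def)

lemma poly_op_pCons:
  assumes T: "bounded_clinear T"
  shows "poly_op (pCons a p) T x = a *\<^sub>C x + T (poly_op p T x)"
proof -
  have "poly_op (pCons a p) T x = (\<Sum>i\<le>Suc (degree p). coeff (pCons a p) i *\<^sub>C (T ^^ i) x)"
    by (rule poly_op_eq_sum) (simp add: degree_pCons_le)
  also have "\<dots> = a *\<^sub>C x + (\<Sum>i\<le>degree p. coeff p i *\<^sub>C T ((T ^^ i) x))"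
    by (simp add: sum.atMost_Suc_shift del: sum.atMost_Suc)
  finally show ?thesis
    by (simp add: poly_op_def bounded_clinear_sum[OF T] bounded_clinear_scaleC[OF T])
qed

lemma poly_op_add: "poly_op (p + q) T x = poly_op p T x + poly_op q T x"
proof -
  define N where "N = max (degree p) (degree q)"
  have "degree p \<le> N" "degree q \<le> N" "degree (p + q) \<le> N"
    by (auto simp: N_def degree_add_le)
  then show ?thesis
    by (simp add: poly_op_eq_sum[of _ N] complex_vector.scale_left_distrib sum.distrib)
qed

lemma poly_op_smult: "poly_op (smult c p) T x = c *\<^sub>C poly_op p T x"
  using poly_op_eq_sum[of "smult c p" "degree p" T x]
  by (simp add: degree_smult_le poly_op_def complex_vector.scale_sum_right scaleC_scaleC)

lemma poly_op_diff: "poly_op (p - q) T x = poly_op p T x - poly_op q T x"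
  using poly_op_add[of p "smult (-1) q" T x] poly_op_smult[of "-1" q T x] by simp

lemma bounded_clinear_poly_op:
  assumes "bounded_clinear T"
  shows "bounded_clinear (poly_op p T)"
  unfolding poly_op_def using assms by (intro bounded_clinear_intros)

lemma poly_op_mult:
  assumes T: "bounded_clinear T"
  shows "poly_op (p * q) T x = poly_op p T (poly_op q T x)"
  by (induction p) (simp_all add: poly_op_add poly_op_smult poly_op_pCons[OF T])

lemma poly_op_linear:
  assumes "bounded_clinear T"
  shows "poly_op [:z, -1:] T x = z *\<^sub>C x - T x"
  using bounded_clinear_scaleC[OF assms, of "-1" x]
  by (simp add: poly_op_pCons assms bounded_clinear_0)

text \<open>Induction on the degree: a root \<open>a\<close> of \<open>p\<close> lies outside the
  spectrum, so the factor \<open>a - T\<close> is invertible, and the cofactor has smaller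
  degree.\<close>

lemma invertible_poly_op:
  assumes T: "bounded_clinear T" and "op_spectrum T \<noteq> {}"
    and "\<And>z. z \<in> op_spectrum T \<Longrightarrow> poly p z \<noteq> 0"
  shows "invertible_op (poly_op p T)"
  using assms(3)
proof (induction "degree p" arbitrary: p)
  case 0
  then obtain c where p: "p = [:c:]" using degree_eq_zeroE by metis
  \<comment> \<open>A point of the spectrum excludes the zero polynomial.\<close>
  then have "c \<noteq> 0" using assms(2) 0 by auto
  moreover have "poly_op p T = (\<lambda>x. c *\<^sub>C x)"
    by (auto simp: p poly_op_pCons[OF T] bounded_clinear_0[OF T])
  ultimately show ?case using invertible_op_scaleC[OF _ invertible_op_ident] by simp
next
  case (Suc n)
  then have "\<not> constant (poly p)" by (simp add: constant_degree)
  then obtain a where a: "poly p a = 0" using fundamental_theorem_of_algebra by blast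
  then obtain q where "p = [:- a, 1:] * q" unfolding poly_eq_0_iff_dvd by blast
  \<comment> \<open>The sign goes into the cofactor so that the linear factor becomes
    \<open>a - T\<close>, as in \<open>op_spectrum\<close>.\<close>
  then have p: "p = [:a, -1:] * - q" by simp
  have "q \<noteq> 0" using Suc.hyps(2) p by auto
  then have "degree p = Suc (degree (- q))" unfolding p by (subst degree_mult_eq) auto
  then have "n = degree (- q)" using Suc.hyps(2) by simp
  moreover have "poly (- q) z \<noteq> 0" if "z \<in> op_spectrum T" for z
    using Suc.prems[OF that] by (simp add: p)
  ultimately have "invertible_op (poly_op (- q) T)" by (rule Suc.hyps(1))
  moreover have "invertible_op (poly_op [:a, -1:] T)"
    using a Suc.prems[of a] unfolding poly_op_linear[OF T] not_in_op_spectrum_iff[symmetric] by blast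
  ultimately have "invertible_op (\<lambda>x. poly_op [:a, -1:] T (poly_op (- q) T x))"
    by (rule invertible_op_compose[rotated])
  then show ?case by (simp only: p poly_op_mult[OF T, symmetric])
qed

text \<open>If \<open>[:\<mu>:] - p\<close> has no zero on the spectrum, its operator is invertible.
  If it has a zero \<open>z\<close> there, \<open>z - T\<close> is a commuting factor, and
  invertibility of the product would pass to it.\<close>

lemma op_spectrum_poly_op:
  fixes T :: "'a::complex_banach \<Rightarrow> 'a"
  assumes T: "bounded_clinear T" and "\<exists>x::'a. x \<noteq> 0"
  shows "op_spectrum (poly_op p T) = poly p ` op_spectrum T"
proof -
  have diff: "(\<lambda>x. \<mu> *\<^sub>C x - poly_op p T x) = poly_op ([:\<mu>:] - p) T" for \<mu>
    by (auto simp: poly_op_diff poly_op_pCons[OF T] bounded_clinear_0[OF T])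
  show ?thesis
  proof (intro equalityI subsetI)
    fix \<mu> assume "\<mu> \<in> op_spectrum (poly_op p T)"
    then have "\<not> invertible_op (poly_op ([:\<mu>:] - p) T)" by (simp add: op_spectrum_def diff)
    then obtain z where "z \<in> op_spectrum T" "poly ([:\<mu>:] - p) z = 0"
      using invertible_poly_op[OF T op_spectrum_nonempty[OF T assms(2)]] by blast
    then show "\<mu> \<in> poly p ` op_spectrum T" by auto
  next
    fix \<mu> assume "\<mu> \<in> poly p ` op_spectrum T"
    then obtain z where z: "z \<in> op_spectrum T" "\<mu> = poly p z" by blast
    then have "poly ([:\<mu>:] - p) z = 0" by simp
    then obtain q where "[:\<mu>:] - p = [:- z, 1:] * q" unfolding poly_eq_0_iff_dvd by blast
    then have q: "[:\<mu>:] - p = - q * [:z, -1:]" by (simp add: mult.commute)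
    have "invertible_op (poly_op [:z, -1:] T)"
      if "invertible_op (poly_op ([:\<mu>:] - p) T)"
    proof (rule invertible_op_commuting_factor)
      show "bounded_clinear (poly_op (- q) T)" "bounded_clinear (poly_op [:z, -1:] T)"
        using T by (auto intro: bounded_clinear_poly_op)
      show "poly_op (- q) T (poly_op [:z, -1:] T x) = poly_op [:z, -1:] T (poly_op (- q) T x)" for x
        by (simp only: poly_op_mult[OF T, symmetric] mult.commute)
      show "invertible_op (\<lambda>x. poly_op (- q) T (poly_op [:z, -1:] T x))"
        using that by (simp only: q poly_op_mult[OF T, symmetric])
    qed
    then show "\<mu> \<in> op_spectrum (poly_op p T)"
      using z(1) unfolding poly_op_linear[OF T] op_spectrum_def diff by blast
  qed
qed

section \<open>Spectrum of the inverse and spectral radius\<close>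

lemma zero_in_op_spectrum_iff:
  assumes "bounded_clinear T"
  shows "0 \<in> op_spectrum T \<longleftrightarrow> \<not> invertible_op T"
proof -
  have "invertible_op (\<lambda>x. 0 *\<^sub>C x - T x)" if "invertible_op T"
    using invertible_op_scaleC[OF _ that, of "-1"] by simp
  moreover have "invertible_op T" if "invertible_op (\<lambda>x. 0 *\<^sub>C x - T x)"
    using invertible_op_scaleC[OF _ that, of "-1"] by simp
  ultimately show ?thesis by (auto simp: op_spectrum_def)
qed

text \<open>\<open>w - V = - w (w^-1 - V^-1) V\<close> gives one inclusion; the same inclusion for
  \<open>inv V\<close>, whose inverse is \<open>V\<close>, gives the other.\<close>

lemma op_spectrum_inv:
  assumes "invertible_op V"
  shows "op_spectrum (inv V) = inverse ` op_spectrum V"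
proof -
  have incl: "inverse w \<in> op_spectrum (inv V)" if V: "invertible_op V" and w: "w \<in> op_spectrum V"
    for V :: "'a \<Rightarrow> 'a" and w
  proof (rule ccontr)
    have "w \<noteq> 0"
      using zero_in_op_spectrum_iff[OF invertible_op_bounded_clinear[OF V]] V w by blast
    assume "inverse w \<notin> op_spectrum (inv V)"
    then have "invertible_op (\<lambda>x. inverse w *\<^sub>C x - inv V x)" by (simp add: not_in_op_spectrum_iff)
    then have "invertible_op (\<lambda>x. (- w) *\<^sub>C (inverse w *\<^sub>C V x - inv V (V x)))"
      using \<open>w \<noteq> 0\<close> invertible_op_scaleC[OF _ invertible_op_compose[OF _ V], of "- w"] by simp
    moreover have "(- w) *\<^sub>C (inverse w *\<^sub>C V x - inv V (V x)) = w *\<^sub>C x - V x" for x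
      using \<open>w \<noteq> 0\<close> by (simp add: invertible_op_inv(2)[OF V] complex_vector.scale_right_diff_distrib)
    ultimately show False using w by (simp add: op_spectrum_def)
  qed
  show ?thesis
  proof (intro equalityI subsetI)
    fix w assume "w \<in> op_spectrum (inv V)"
    then have "inverse w \<in> op_spectrum V"
      using incl[OF invertible_op_inv(3)[OF assms]] by (simp add: invertible_op_inv(4)[OF assms])
    then show "w \<in> inverse ` op_spectrum V" by (metis image_eqI inverse_inverse_eq)
  qed (use incl[OF assms] in auto)
qed

lemma op_spectral_radius_upper:
  fixes T :: "'a::complex_banach \<Rightarrow> 'a"
  assumes "bounded_clinear T" "z \<in> op_spectrum T"
  shows "cmod z \<le> op_spectral_radius T"
  unfolding op_spectral_radius_def
proof (rule cSUP_upper[OF assms(2)])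
  show "bdd_above (cmod ` op_spectrum T)"
    using compact_imp_bounded[OF compact_op_spectrum[OF assms(1)]]
    by (auto simp: bounded_iff bdd_above_def)
qed

lemma op_spectral_radius_nonneg:
  fixes T :: "'a::complex_banach \<Rightarrow> 'a"
  assumes "bounded_clinear T" "op_spectrum T \<noteq> {}"
  shows "0 \<le> op_spectral_radius T"
  using assms op_spectral_radius_upper norm_ge_zero order_trans by (metis ex_in_conv)

section \<open>Spectral radii compared with the polynomial hull\<close>

theorem theorem1p4:
  fixes A :: "'a::complex_banach \<Rightarrow> 'a" and B :: "'b::complex_banach \<Rightarrow> 'b"
  assumes "\<exists>x::'a. x \<noteq> 0" and "\<exists>y::'b. y \<noteq> 0"
    and "bounded_clinear A" and "bounded_clinear B"
  shows "(\<exists>p :: complex poly. invertible_op (poly_op p B) \<and>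
            op_spectral_radius (poly_op p A) * op_spectral_radius (inv (poly_op p B)) < 1)
         \<longleftrightarrow> polynomial_hull (op_spectrum A) \<inter> op_spectrum B = {}"
proof -
  define K where "K = op_spectrum A"
  define L where "L = op_spectrum B"
  have K: "compact K" "K \<noteq> {}" and L: "compact L" "L \<noteq> {}"
    unfolding K_def L_def using assms by (simp_all add: compact_op_spectrum op_spectrum_nonempty)
  have invertible_iff: "invertible_op (poly_op p B) \<longleftrightarrow> (\<forall>z\<in>L. poly p z \<noteq> 0)" for p
    using zero_in_op_spectrum_iff[OF bounded_clinear_poly_op[OF assms(4)], of p]
    unfolding op_spectrum_poly_op[OF assms(4,2)] L_def by force
  have radius_A: "op_spectral_radius (poly_op p A) = (SUP w\<in>K. cmod (poly p w))" for p
    unfolding op_spectral_radius_def op_spectrum_poly_op[OF assms(3,1)] K_def by (simp add: image_image)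
  have spectrum_B: "op_spectrum (inv (poly_op p B)) = (\<lambda>z. inverse (poly p z)) ` L"
    if "invertible_op (poly_op p B)" for p
    unfolding op_spectrum_inv[OF that] op_spectrum_poly_op[OF assms(4,2)] L_def by (simp add: image_image)
  show ?thesis
    unfolding K_def[symmetric] L_def[symmetric]
  proof
    assume "\<exists>p. invertible_op (poly_op p B) \<and>
      op_spectral_radius (poly_op p A) * op_spectral_radius (inv (poly_op p B)) < 1"
    then obtain p where p: "invertible_op (poly_op p B)"
      "op_spectral_radius (poly_op p A) * op_spectral_radius (inv (poly_op p B)) < 1" by blast
    show "polynomial_hull K \<inter> L = {}"
    proof (rule ccontr)
      assume "polynomial_hull K \<inter> L \<noteq> {}"
      then obtain z where z: "z \<in> polynomial_hull K" "z \<in> L" by blast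
      \<comment> \<open>Membership in the hull bounds \<open>cmod (poly p z)\<close> by the first
        radius, membership in \<open>L\<close> bounds its reciprocal by the second, so the product
        of the radii is at least 1.\<close>
      have "poly p z \<noteq> 0" using p(1) z(2) invertible_iff by blast
      have A: "cmod (poly p z) \<le> op_spectral_radius (poly_op p A)"
        using z(1) by (simp add: polynomial_hull_def radius_A)
      have "cmod (inverse (poly p z)) \<le> op_spectral_radius (inv (poly_op p B))"
        using z(2) spectrum_B[OF p(1)] invertible_op_inv(3)[OF p(1)]
        by (intro op_spectral_radius_upper invertible_op_bounded_clinear) auto
      with A have "cmod (poly p z) * cmod (inverse (poly p z)) \<le>
          op_spectral_radius (poly_op p A) * op_spectral_radius (inv (poly_op p B))"
        by (intro mult_mono) (auto intro: order_trans[OF norm_ge_zero])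
      then show False using p(2) \<open>poly p z \<noteq> 0\<close> by (simp add: norm_inverse)
    qed
  next
    assume "polynomial_hull K \<inter> L = {}"
    then obtain p s m where p: "0 \<le> s" "s < m" "\<And>w. w \<in> K \<Longrightarrow> cmod (poly p w) \<le> s"
      "\<And>z. z \<in> L \<Longrightarrow> m \<le> cmod (poly p z)"
      using polynomial_separation[OF K L(1)] by metis
    \<comment> \<open>On \<open>L\<close> the modulus of \<open>p\<close> is at least
      \<open>m\<close>, which is positive.\<close>
    have inv: "invertible_op (poly_op p B)"
      unfolding invertible_iff using p by fastforce
    have "op_spectral_radius (poly_op p A) \<le> s"
      unfolding radius_A using K(2) p(3) by (rule cSUP_least)
    moreover have "op_spectral_radius (inv (poly_op p B)) \<le> inverse m"
      unfolding op_spectral_radius_def spectrum_B[OF inv] image_image using L(2)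
    proof (rule cSUP_least)
      show "cmod (inverse (poly p z)) \<le> inverse m" if "z \<in> L" for z
        using p(1,2) p(4)[OF that] by (simp add: norm_inverse le_imp_inverse_le)
    qed
    \<comment> \<open>Multiplying the two upper bounds requires this sign as well as
      \<open>0 \<le> s\<close>.\<close>
    moreover have "0 \<le> op_spectral_radius (inv (poly_op p B))"
      using L(2) spectrum_B[OF inv] inv
      by (intro op_spectral_radius_nonneg invertible_op_bounded_clinear invertible_op_inv(3)) auto
    ultimately have "op_spectral_radius (poly_op p A) * op_spectral_radius (inv (poly_op p B))
        \<le> s * inverse m"
      using p(1) by (intro mult_mono)
    also have "\<dots> < 1" using p(1,2) by (simp add: field_simps)
    finally show "\<exists>p. invertible_op (poly_op p B) \<and>
      op_spectral_radius (poly_op p A) * op_spectral_radius (inv (poly_op p B)) < 1"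
      using inv by blast
  qed
qed

end
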